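(* For any (probabilistic bounded error or deterministic) symbolic algorithm that solves $\text{Büchi}(T)$, the following lower bounds on the required number of symbolic one-step operations hold: (1) $\Omega(n)$ even for instances with constant diameter $D$; (2) $\Omega(D)$ even for instances with $|T|=1$; (3) $\Omega(|T|)$ even for instances with constant $D$; (4) $\Omega(|T|+D)$; and (5) $\Omega\big(|SCCs(G)|+\sum_{C\in SCCs(G)}D_C\big)$.
   Context: Symbolic model: the input is a finite directed graph $G=(V,E)$ (self-loops allowed), $n=|V|$, together with a starting vertex $s\in V$ and a target set $T\subseteq V$. The algorithm knows $V$, $s$, $T$, but it can access $E$ only through the one-step operations $\mathrm{Pre}(S)=\{v\in V\mid \exists s'\in S:(v,s')\in E\}$ and $\mathrm{Post}(S)=\{v\in V\mid \exists s'\in S:(s',v)\in E\}$ applied to (adaptively chosen) sets $S\subseteq V$. All other computation, in particular basic set operations on vertex sets, is unrestricted and not counted in lower bounds; any number of sets may be stored. A probabilistic bounded error algorithm may use random bits and must be correct with probability at least $2/3$ on every (admissible) input. $\text{Büchi}(T)$ (liveness): decide whether there is an infinite path in $G$ starting from $s$ that visits some vertex of $T$ infinitely often. Convention for lower bounds: a lower bound $\Omega(g)$, for a parameter $g$ of the input, means: there is an absolute constant $c>0$ such that every (deterministic or probabilistic bounded error) symbolic algorithm solving the problem performs, on inputs with arbitrarily large $g$, at least $c\cdot g$ one-step operations (worst case over its random choices). "Even for instances with property $P$" means that this already holds when the algorithm need only be correct on instances with property $P$, the hard inputs having property $P$; "constant $D$" means $D\le d_0$ for some fixed constant $d_0$.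 The diameter $D$ of $G$ is the largest finite distance: the maximum of $d(u,v)$ over all pairs $u,v$ such that $u$ can reach $v$, where $d(u,v)$ is the smallest number of edges on a path from $u$ to $v$. $SCCs(G)$ is the set of strongly connected components of $G$, and $D_C$ is the diameter of (the subgraph induced by) the component $C$. *)

theory Defs
  imports
    "HOL-Probability.Probability"
    "Graph_Theory.Pair_Digraph"
    "Graph_Theory.Digraph_Component"
begin

section \<open>Graphs\<close>

text \<open>
  Input graphs are of type \<^typ>\<open>nat pair_pre_digraph\<close>: the arcs are a binary relation on the
  vertices, self-loops allowed. Vertices are natural numbers; every finite graph is isomorphic to
  such a graph. Strongly connected components are the library's \<^const>\<open>pre_digraph.sccs\<close>, i.e.
  the maximal strongly connected induced subgraphs.
\<close>

definition digraph_dist :: "('a, 'b) pre_digraph \<Rightarrow> 'a \<Rightarrow> 'a \<Rightarrow> nat" where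
  "digraph_dist G u v = (LEAST k. \<exists>p. pre_digraph.awalk G u p v \<and> length p = k)"

definition digraph_diameter :: "('a, 'b) pre_digraph \<Rightarrow> nat" where
  "digraph_diameter G = Max {digraph_dist G u v | u v. u \<rightarrow>\<^sup>*\<^bsub>G\<^esub> v}"

definition Pre :: "'a pair_pre_digraph \<Rightarrow> 'a set \<Rightarrow> 'a set" where
  "Pre G S = {v \<in> pverts G. \<exists>s'\<in>S. (v, s') \<in> parcs G}"

definition Post :: "'a pair_pre_digraph \<Rightarrow> 'a set \<Rightarrow> 'a set" where
  "Post G S = {v \<in> pverts G. \<exists>s'\<in>S. (s', v) \<in> parcs G}"

section \<open>Inputs and the problem\<close>

record input =
  graph_of :: "nat pair_pre_digraph"
  start_of :: nat
  target_of :: "nat set"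

definition valid_input :: "input \<Rightarrow> bool" where
  "valid_input I \<longleftrightarrow>
     pair_fin_digraph (graph_of I) \<and>
     start_of I \<in> pverts (graph_of I) \<and>
     target_of I \<subseteq> pverts (graph_of I)"

definition buchi :: "input \<Rightarrow> bool" where
  "buchi I \<longleftrightarrow>
     (\<exists>p :: nat \<Rightarrow> nat. p 0 = start_of I \<and>
        (\<forall>i. (p i, p (Suc i)) \<in> parcs (graph_of I)) \<and>
        (\<exists>t\<in>target_of I. infinite {i. p i = t}))"

definition num_vertices :: "input \<Rightarrow> nat" where
  "num_vertices I = card (pverts (graph_of I))"

definition num_targets :: "input \<Rightarrow> nat" where
  "num_targets I = card (target_of I)"

definition diam :: "input \<Rightarrow> nat" where
  "diam I = digraph_diameter (with_proj (graph_of I))"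

definition scc_measure :: "input \<Rightarrow> nat" where
  "scc_measure I =
     card (pre_digraph.sccs (with_proj (graph_of I))) +
     (\<Sum>C\<in>pre_digraph.sccs (with_proj (graph_of I)). digraph_diameter C)"

section \<open>Symbolic algorithms\<close>

text \<open>
  Since only one-step operations are counted and all other computation and storage is free, a
  symbolic algorithm is an arbitrary adaptive strategy: from \<open>V\<close>, \<open>s\<close>, \<open>T\<close> and the list of
  results of the operations performed so far (oldest first), it determines its next action.
  Edges lie within the vertex set, so operations on sets that are not subsets of \<open>V\<close> have no
  additional power and need not be excluded.
\<close>

datatype action = DoPre "nat set" | DoPost "nat set" | Answer bool

type_synonym symbolic_alg = "nat set \<Rightarrow> nat \<Rightarrow> nat set \<Rightarrow> nat set list \<Rightarrow> action"

definition next_action :: "symbolic_alg \<Rightarrow> input \<Rightarrow> nat set list \<Rightarrow> action" where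
  "next_action A I = A (pverts (graph_of I)) (start_of I) (target_of I)"

text \<open>The results obtained in the first \<open>k\<close> steps; the list stops growing once an answer is given.\<close>

primrec history :: "symbolic_alg \<Rightarrow> input \<Rightarrow> nat \<Rightarrow> nat set list" where
  "history A I 0 = []"
| "history A I (Suc k) =
     (let h = history A I k in
      case next_action A I h of
        DoPre S \<Rightarrow> h @ [Pre (graph_of I) S]
      | DoPost S \<Rightarrow> h @ [Post (graph_of I) S]
      | Answer b \<Rightarrow> h)"

definition outputs :: "symbolic_alg \<Rightarrow> input \<Rightarrow> bool \<Rightarrow> bool" where
  "outputs A I b \<longleftrightarrow> (\<exists>k. next_action A I (history A I k) = Answer b)"

text \<open>The number of one-step operations performed, infinite if the run never answers.\<close>

definition num_ops :: "symbolic_alg \<Rightarrow> input \<Rightarrow> enat" where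
  "num_ops A I = (SUP k. enat (length (history A I k)))"

text \<open>
  A probabilistic algorithm additionally reads an infinite tape of independent fair random bits;
  fixing the tape yields a deterministic algorithm.
\<close>

type_synonym prob_symbolic_alg = "(nat \<Rightarrow> bool) \<Rightarrow> symbolic_alg"

definition random_tape :: "(nat \<Rightarrow> bool) measure" where
  "random_tape = PiM UNIV (\<lambda>_. measure_pmf (bernoulli_pmf (1/2)))"

definition worst_case_ops :: "prob_symbolic_alg \<Rightarrow> input \<Rightarrow> enat" where
  "worst_case_ops R I = (SUP \<omega>. num_ops (R \<omega>) I)"

text \<open>
  Below, \<open>P\<close> is the property of the instances on which the algorithm has to be correct. In the
  probabilistic case, the set of tapes leading to the correct answer is implicitly required to be
  measurable, because \<^const>\<open>measure\<close> is zero on non-measurable sets.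
\<close>

definition solves_buchi :: "(input \<Rightarrow> bool) \<Rightarrow> symbolic_alg \<Rightarrow> bool" where
  "solves_buchi P A \<longleftrightarrow> (\<forall>I. valid_input I \<and> P I \<longrightarrow> outputs A I (buchi I))"

definition prob_solves_buchi :: "(input \<Rightarrow> bool) \<Rightarrow> prob_symbolic_alg \<Rightarrow> bool" where
  "prob_solves_buchi P R \<longleftrightarrow>
     (\<forall>I. valid_input I \<and> P I \<longrightarrow>
        measure random_tape {\<omega>. outputs (R \<omega>) I (buchi I)} \<ge> 2/3)"

section \<open>Lower bounds\<close>

definition buchi_lower_bound :: "(input \<Rightarrow> bool) \<Rightarrow> (input \<Rightarrow> nat) \<Rightarrow> bool" where
  "buchi_lower_bound P g \<longleftrightarrow>
     (\<exists>c::real. c > 0 \<and>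
        (\<forall>A. solves_buchi P A \<longrightarrow>
           (\<forall>N. \<exists>I. valid_input I \<and> P I \<and> g I \<ge> N \<and>
              ereal_of_enat (num_ops A I) \<ge> ereal (c * real (g I)))) \<and>
        (\<forall>R. prob_solves_buchi P R \<longrightarrow>
           (\<forall>N. \<exists>I. valid_input I \<and> P I \<and> g I \<ge> N \<and>
              ereal_of_enat (worst_case_ops R I) \<ge> ereal (c * real (g I)))))"

end

theory Submission
  imports Defs
begin

text \<open>
  A base input is compared with \<open>m\<close> inputs of the opposite answer, each differing from it in a
  single arc, hidden by the other arcs so well that every one-step operation tells at most one of
  the \<open>m\<close> inputs apart from the base input. A tape on which the algorithm is correct on both the base
  input and the \<open>i\<close>-th variant must, on the base input, use an operation that tells them apart; for
  each \<open>i\<close> this happens with probability at least \<open>1/3\<close>. Averaging over the tapes, some run on the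
  base input uses at least \<open>m/3\<close> operations.

  For the bounds in \<open>n\<close>, \<open>|T|\<close>, \<open>|T| + D\<close> and the component measure, the base input is a transitive
  tournament on \<open>n\<close> vertices, all of them targets, and the variants add a loop at one vertex:
  the loop at \<open>i\<close> is visible to \<open>Post S\<close> only if \<open>i\<close> is the minimum of \<open>S\<close>, and to \<open>Pre S\<close> only if it
  is the maximum. For the bound in \<open>D\<close>, the base input is a path with all backward arcs whose last
  vertex is the only target, and the variants delete one arc of the path.
\<close>

section \<open>Runs of symbolic algorithms\<close>

text \<open>The value at \<open>Answer\<close> is a default independent of the graph, so an action
  with different results on two graphs is always a one-step operation.\<close>

fun op_result :: "nat pair_pre_digraph \<Rightarrow> action \<Rightarrow> nat set" where
  "op_result G (DoPre S) = Pre G S"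
| "op_result G (DoPost S) = Post G S"
| "op_result G (Answer b) = {}"

definition same_interface :: "input \<Rightarrow> input \<Rightarrow> bool" where
  "same_interface I J \<longleftrightarrow> pverts (graph_of J) = pverts (graph_of I) \<and>
     start_of J = start_of I \<and> target_of J = target_of I"

lemma history_Suc_op:
  assumes "\<And>b. next_action A I (history A I k) \<noteq> Answer b"
  shows "history A I (Suc k) =
    history A I k @ [op_result (graph_of I) (next_action A I (history A I k))]"
  using assms by (cases "next_action A I (history A I k)") (auto simp: Let_def)

lemma history_Suc_Answer:
  assumes "next_action A I (history A I k) = Answer b"
  shows "history A I (Suc k) = history A I k"
  using assms by (simp add: Let_def)

lemma history_after_Answer:
  assumes "next_action A I (history A I k) = Answer b" and "k \<le> j"
  shows "history A I j = history A I k"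
  using assms(2)
proof (induction j rule: dec_induct)
  case (step j)
  then show ?case using assms(1) history_Suc_Answer by metis
qed simp

lemma outputs_unique:
  assumes "outputs A I b" and "outputs A I b'"
  shows "b = b'"
proof -
  obtain k k' where k: "next_action A I (history A I k) = Answer b"
    and k': "next_action A I (history A I k') = Answer b'"
    using assms unfolding outputs_def by blast
  have "history A I k' = history A I k"
    using history_after_Answer[OF k] history_after_Answer[OF k'] nat_le_linear by metis
  then show ?thesis using k k' by simp
qed

lemma length_history_running:
  assumes "\<And>b. next_action A I (history A I k) \<noteq> Answer b"
  shows "length (history A I k) = k"
  using assms
proof (induction k)
  case (Suc k)
  have running: "next_action A I (history A I k) \<noteq> Answer b" for b
    using Suc.prems history_Suc_Answer by metis
  then have "length (history A I k) = k"
    by (rule Suc.IH)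
  with history_Suc_op[of A I k] running show ?case by simp
qed simp

lemma running_step_less_num_ops:
  assumes "\<And>b. next_action A I (history A I k) \<noteq> Answer b"
    and "num_ops A I \<le> enat q"
  shows "k < q"
proof -
  have "length (history A I (Suc k)) = Suc k"
    using history_Suc_op[OF assms(1)] length_history_running[OF assms(1)] by simp
  moreover have "enat (length (history A I (Suc k))) \<le> num_ops A I"
    unfolding num_ops_def by (rule SUP_upper) simp
  ultimately have "enat (Suc k) \<le> enat q"
    using assms(2) order_trans by metis
  then show ?thesis by simp
qed

text \<open>Otherwise the two histories agree by induction on \<open>k\<close>, and both runs would
  give the same answer.\<close>

lemma distinguishing_step_exists:
  assumes "same_interface I J"
    and "outputs A I b" and "outputs A J b'" and "b \<noteq> b'"
  shows "\<exists>k. op_result (graph_of J) (next_action A I (history A I k)) \<noteq>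
    op_result (graph_of I) (next_action A I (history A I k))"
proof (rule ccontr)
  assume "\<not> ?thesis"
  then have same: "op_result (graph_of J) (next_action A I (history A I k)) =
      op_result (graph_of I) (next_action A I (history A I k))" for k
    by blast
  have act: "next_action A J = next_action A I"
    using assms(1) by (auto simp: same_interface_def next_action_def)
  have "history A J k = history A I k" for k
  proof (induction k)
    case (Suc k)
    show ?case
      using same[of k] Suc act
      by (cases "next_action A I (history A I k)") (simp_all add: Let_def)
  qed simp
  then have "outputs A J b"
    using assms(2) act by (simp add: outputs_def)
  then show False
    using outputs_unique assms(3,4) by blast
qed

section \<open>Averaging over the random tape\<close>

lemma prob_space_random_tape: "prob_space random_tape"
  unfolding random_tape_def by (intro prob_space_PiM prob_space_measure_pmf)

lemma space_random_tape: "space random_tape = UNIV"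
  by (simp add: random_tape_def space_PiM)

text \<open>The expected number of events \<open>E i\<close> that occur is the sum of their
  probabilities, and it is at most any pointwise bound \<open>q\<close>.\<close>

lemma (in prob_space) double_counting_bound:
  fixes m :: nat and q :: real
  assumes meas: "\<And>i. i < m \<Longrightarrow> E i \<in> events"
    and prob: "\<And>i. i < m \<Longrightarrow> p \<le> prob (E i)"
    and count: "\<And>\<omega>. \<omega> \<in> space M \<Longrightarrow> real (card {i. i < m \<and> \<omega> \<in> E i}) \<le> q"
  shows "real m * p \<le> q"
proof -
  have "real m * p = (\<Sum>i<m. p)" by simp
  also have "\<dots> \<le> (\<Sum>i<m. prob (E i))"
    using prob by (intro sum_mono) auto
  also have "\<dots> = (\<Sum>i<m. expectation (indicat_real (E i)))"
    using meas by (intro sum.cong) auto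
  also have "\<dots> = expectation (\<lambda>\<omega>. \<Sum>i<m. indicat_real (E i) \<omega>)"
    using meas by (intro Bochner_Integration.integral_sum[symmetric]) (auto simp: emeasure_eq_measure)
  also have "\<dots> \<le> expectation (\<lambda>\<omega>. q)"
  proof (rule integral_mono)
    show "integrable M (\<lambda>\<omega>. \<Sum>i<m. indicat_real (E i) \<omega>)"
      using meas by (intro Bochner_Integration.integrable_sum) (auto simp: emeasure_eq_measure)
    fix \<omega> assume "\<omega> \<in> space M"
    have "(\<Sum>i<m. indicat_real (E i) \<omega>) = real (card {i. i < m \<and> \<omega> \<in> E i})"
      by (simp add: indicator_def sum.If_cases Int_def)
    also have "\<dots> \<le> q" using count \<open>\<omega> \<in> space M\<close> by blast
    finally show "(\<Sum>i<m. indicat_real (E i) \<omega>) \<le> q" .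
  qed simp
  also have "\<dots> = q" by (simp add: prob_space)
  finally show ?thesis .
qed

lemma (in prob_space) prob_Int_ge:
  assumes "A \<in> events" and "B \<in> events"
  shows "prob A + prob B - 1 \<le> prob (A \<inter> B)"
  using finite_measure_Union'[OF assms] finite_measure_Diff'[OF assms(2,1)]
    prob_le_1[of "A \<union> B"] by (simp add: Int_commute)

text \<open>Since \<open>measure\<close> is 0 on non-measurable sets, a success probability of at
  least 2/3 already yields measurability.\<close>

lemma measure_pos_imp_in_sets: "0 < measure M A \<Longrightarrow> A \<in> sets M"
  using measure_notin_sets by fastforce

section \<open>From indistinguishable families to lower bounds\<close>

text \<open>The last clause ranges over every action, not those of a particular algorithm, so one
  family serves against all algorithms.\<close>

definition hard_family :: "(input \<Rightarrow> bool) \<Rightarrow> nat \<Rightarrow> input \<Rightarrow> (nat \<Rightarrow> input) \<Rightarrow> bool" where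
  "hard_family P m I J \<longleftrightarrow> valid_input I \<and> P I \<and>
     (\<forall>i<m. valid_input (J i) \<and> P (J i) \<and> same_interface I (J i) \<and> buchi (J i) \<noteq> buchi I) \<and>
     (\<forall>act. \<forall>i<m. \<forall>j<m.
        op_result (graph_of (J i)) act \<noteq> op_result (graph_of I) act \<longrightarrow>
        op_result (graph_of (J j)) act \<noteq> op_result (graph_of I) act \<longrightarrow> i = j)"

text \<open>Each counted index has a step of the run on \<open>I\<close> that exposes it. No step
  exposes two variants, so this assignment is injective into the steps below
  \<open>q\<close>.\<close>

lemma card_refuted_le_num_ops:
  assumes fam: "hard_family P m I J"
    and ops: "num_ops A I \<le> enat q"
  shows "card {i. i < m \<and> outputs A I (buchi I) \<and> outputs A (J i) (buchi (J i))} \<le> q"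
    (is "card ?E \<le> q")
proof -
  let ?act = "\<lambda>k. next_action A I (history A I k)"
  let ?dist = "\<lambda>i k. op_result (graph_of (J i)) (?act k) \<noteq> op_result (graph_of I) (?act k)"
  have "\<exists>k. ?dist i k" if "i \<in> ?E" for i
    using that fam by (intro distinguishing_step_exists) (auto simp: hard_family_def)
  then obtain step where step: "\<And>i. i \<in> ?E \<Longrightarrow> ?dist i (step i)"
    by metis
  have "step ` ?E \<subseteq> {..<q}"
  proof safe
    fix i assume "i < m" "outputs A I (buchi I)" "outputs A (J i) (buchi (J i))"
    then have "?dist i (step i)" using step by blast
    then have "?act (step i) \<noteq> Answer b" for b by auto
    then show "step i < q" using ops by (rule running_step_less_num_ops)
  qed
  moreover have "inj_on step ?E"
  proof (rule inj_onI)
    fix i j assume ij: "i \<in> ?E" "j \<in> ?E" "step i = step j"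
    then have "?dist i (step i)" "?dist j (step i)" using step[of i] step[of j] by simp_all
    then show "i = j" using fam ij unfolding hard_family_def by blast
  qed
  ultimately have "card ?E \<le> card {..<q}"
    by (intro card_inj_on_le) auto
  then show ?thesis by simp
qed

text \<open>
  Only the sets of tapes with correct answers are known to be measurable, not the set of tapes on
  which some operation is performed; hence the averaging uses the former.
\<close>

lemma worst_case_ops_ge:
  assumes fam: "hard_family P m I J" and R: "prob_solves_buchi P R"
  shows "ereal (real m / 3) \<le> ereal_of_enat (worst_case_ops R I)"
proof (cases "worst_case_ops R I")
  case (enat q)
  interpret prob_space random_tape by (rule prob_space_random_tape)
  define C where "C X = {\<omega>. outputs (R \<omega>) X (buchi X)}" for X
  have prob: "2/3 \<le> prob (C X)" if "valid_input X" "P X" for X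
    using R that by (simp add: prob_solves_buchi_def C_def)
  have sets: "C X \<in> events" if "valid_input X" "P X" for X
    using prob[OF that] by (intro measure_pos_imp_in_sets) linarith
  have I: "valid_input I" "P I" and J: "\<And>i. i < m \<Longrightarrow> valid_input (J i) \<and> P (J i)"
    using fam by (auto simp: hard_family_def)
  have "real m * (1/3) \<le> real q"
  proof (rule double_counting_bound[where E = "\<lambda>i. C I \<inter> C (J i)"])
    fix i assume "i < m"
    then show "C I \<inter> C (J i) \<in> events" using I J sets by blast
    \<comment> \<open>Both runs are correct with probability at least 2/3 + 2/3 - 1.\<close>
    show "1/3 \<le> prob (C I \<inter> C (J i))"
      using prob_Int_ge[of "C I" "C (J i)"] prob[of I] prob[of "J i"] sets I J \<open>i < m\<close>
      by fastforce
  next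
    fix \<omega>
    have "num_ops (R \<omega>) I \<le> worst_case_ops R I"
      unfolding worst_case_ops_def by (rule SUP_upper) simp
    then have "num_ops (R \<omega>) I \<le> enat q" by (simp add: enat)
    from card_refuted_le_num_ops[OF fam this]
    show "real (card {i. i < m \<and> \<omega> \<in> C I \<inter> C (J i)}) \<le> real q"
      by (simp add: C_def)
  qed
  then show ?thesis by (simp add: enat)
qed simp

text \<open>The set of good tapes is the whole space, of probability 1.\<close>

lemma prob_solves_buchi_deterministic:
  assumes "solves_buchi P A"
  shows "prob_solves_buchi P (\<lambda>_. A)"
proof -
  interpret prob_space random_tape by (rule prob_space_random_tape)
  show ?thesis
    using assms prob_space by (simp add: solves_buchi_def prob_solves_buchi_def space_random_tape)
qed

text \<open>The constant \<open>1 / (3 * a)\<close> combines the \<open>m / 3\<close> operations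
  forced by a family with \<open>g I \<le> a * m\<close>.\<close>

lemma buchi_lower_boundI:
  assumes "a > 0"
    and fam: "\<And>N. \<exists>m I J. hard_family P m I J \<and> N \<le> g I \<and> g I \<le> a * m"
  shows "buchi_lower_bound P g"
  unfolding buchi_lower_bound_def
proof (intro exI[of _ "1 / (3 * real a)"] conjI allI impI)
  show "0 < 1 / (3 * real a)" using \<open>a > 0\<close> by simp
  have bound: "\<exists>I. valid_input I \<and> P I \<and> N \<le> g I \<and>
      ereal (1 / (3 * real a) * real (g I)) \<le> ereal_of_enat (worst_case_ops R I)"
    if R: "prob_solves_buchi P R" for R N
  proof -
    obtain m I J where f: "hard_family P m I J" and N: "N \<le> g I" and g: "g I \<le> a * m"
      using fam by blast
    have "real (g I) \<le> real a * real m"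
      using g by (metis of_nat_le_iff of_nat_mult)
    then have "1 / (3 * real a) * real (g I) \<le> real m / 3"
      using \<open>a > 0\<close> by (simp add: field_simps)
    then have "ereal (1 / (3 * real a) * real (g I)) \<le> ereal_of_enat (worst_case_ops R I)"
      using worst_case_ops_ge[OF f R] by (meson ereal_less_eq(3) order_trans)
    moreover have "valid_input I" "P I" using f by (simp_all add: hard_family_def)
    ultimately show ?thesis using N by blast
  qed
  show "\<exists>I. valid_input I \<and> P I \<and> N \<le> g I \<and>
      ereal (1 / (3 * real a) * real (g I)) \<le> ereal_of_enat (worst_case_ops R I)"
    if "prob_solves_buchi P R" for R N
    using bound[OF that] .
  show "\<exists>I. valid_input I \<and> P I \<and> N \<le> g I \<and>
      ereal (1 / (3 * real a) * real (g I)) \<le> ereal_of_enat (num_ops A I)"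
    if "solves_buchi P A" for A N
    using bound[OF prob_solves_buchi_deterministic[OF that], of N]
    by (simp add: worst_case_ops_def)
qed

section \<open>Distances and diameters\<close>

lemma digraph_dist_le:
  "pre_digraph.awalk G u p v \<Longrightarrow> digraph_dist G u v \<le> length p"
  unfolding digraph_dist_def by (rule Least_le) blast

lemma finite_digraph_dists:
  assumes "finite (verts G)"
  shows "finite {digraph_dist G u v | u v. u \<rightarrow>\<^sup>*\<^bsub>G\<^esub> v}"
proof (rule finite_subset)
  show "{digraph_dist G u v | u v. u \<rightarrow>\<^sup>*\<^bsub>G\<^esub> v}
      \<subseteq> (\<lambda>(u, v). digraph_dist G u v) ` (verts G \<times> verts G)"
    unfolding reachable_def by (auto dest: in_rtrancl_on_in_F)
qed (use assms in simp)

lemma digraph_diameter_le: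
  assumes "finite (verts G)" and "verts G \<noteq> {}"
    and "\<And>u v. u \<rightarrow>\<^sup>*\<^bsub>G\<^esub> v \<Longrightarrow> digraph_dist G u v \<le> d"
  shows "digraph_diameter G \<le> d"
proof -
  obtain x where "x \<in> verts G" using assms(2) by blast
  then have "x \<rightarrow>\<^sup>*\<^bsub>G\<^esub> x" by (simp add: reachable_def)
  then have "{digraph_dist G u v | u v. u \<rightarrow>\<^sup>*\<^bsub>G\<^esub> v} \<noteq> {}" by blast
  then show ?thesis
    unfolding digraph_diameter_def
    using finite_digraph_dists[OF assms(1)] assms(3) by (subst Max_le_iff) auto
qed

lemma digraph_dist_le_diameter:
  assumes "finite (verts G)" and "u \<rightarrow>\<^sup>*\<^bsub>G\<^esub> v"
  shows "digraph_dist G u v \<le> digraph_diameter G"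
  unfolding digraph_diameter_def
  using finite_digraph_dists[OF assms(1)] assms(2) by (intro Max_ge) auto

lemma (in fin_digraph) digraph_dist_less_card:
  assumes "u \<rightarrow>\<^sup>* v"
  shows "digraph_dist G u v < card (verts G)"
proof -
  obtain p where "apath u p v" using assms reachable_apath by blast
  then show ?thesis
    using length_apath_less digraph_dist_le awalkI_apath le_less_trans by metis
qed

lemma digraph_diameter_singleton:
  assumes "verts G = {x}"
  shows "digraph_diameter G = 0"
proof -
  have "digraph_diameter G \<le> 0"
  proof (rule digraph_diameter_le)
    fix u v assume "u \<rightarrow>\<^sup>*\<^bsub>G\<^esub> v"
    then have "u = x" "v = x"
      using assms unfolding reachable_def by (auto dest: in_rtrancl_on_in_F)
    then have "pre_digraph.awalk G u [] v"
      using assms by (simp add: pre_digraph.awalk_def pre_digraph.cas.simps)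
    then show "digraph_dist G u v \<le> 0"
      using digraph_dist_le by fastforce
  qed (use assms in auto)
  then show ?thesis by simp
qed

section \<open>Transitive tournaments with a possible loop\<close>

definition loop_dag :: "nat \<Rightarrow> nat set \<Rightarrow> nat pair_pre_digraph" where
  "loop_dag n L = \<lparr>pverts = {..<n}, parcs = {(u, v). v < n \<and> (u < v \<or> u = v \<and> u \<in> L)}\<rparr>"

definition loop_dag_input :: "nat \<Rightarrow> nat set \<Rightarrow> input" where
  "loop_dag_input n L = \<lparr>graph_of = loop_dag n L, start_of = 0, target_of = {..<n}\<rparr>"

lemma pair_fin_digraph_loop_dag: "pair_fin_digraph (loop_dag n L)"
proof
  show "finite (parcs (loop_dag n L))"
    by (rule finite_subset[of _ "{..<n} \<times> {..<n}"]) (auto simp: loop_dag_def)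
qed (auto simp: loop_dag_def)

lemma loop_dag_reachable_le:
  assumes "u \<rightarrow>\<^sup>*\<^bsub>with_proj (loop_dag n L)\<^esub> v"
  shows "u \<le> v \<and> v < n"
  using assms unfolding reachable_def
  by (induction rule: rtrancl_on.induct) (auto simp: loop_dag_def)

lemma digraph_dist_loop_dag_le:
  assumes "u \<rightarrow>\<^sup>*\<^bsub>with_proj (loop_dag n L)\<^esub> v"
  shows "digraph_dist (with_proj (loop_dag n L)) u v \<le> 1"
proof -
  interpret pair_fin_digraph "loop_dag n L" by (rule pair_fin_digraph_loop_dag)
  have "u \<le> v" "v < n" using loop_dag_reachable_le[OF assms] by auto
  then have "awalk u (if u = v then [] else [(u, v)]) v"
    by (auto simp: awalk_simps) (auto simp: loop_dag_def)
  from digraph_dist_le[OF this] show ?thesis by (auto split: if_splits)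
qed

lemma diam_loop_dag_input_le: "0 < n \<Longrightarrow> diam (loop_dag_input n L) \<le> 1"
proof -
  assume "0 < n"
  then have "digraph_diameter (with_proj (loop_dag n L)) \<le> 1"
    by (intro digraph_diameter_le digraph_dist_loop_dag_le) (auto simp: loop_dag_def)
  then show ?thesis by (simp add: diam_def loop_dag_input_def)
qed

text \<open>Reachability never lowers the vertex number, so every component is a single vertex, of
  diameter 0.\<close>

lemma scc_measure_loop_dag_input:
  "scc_measure (loop_dag_input n {}) = n"
proof -
  let ?G = "loop_dag n {}"
  interpret pair_fin_digraph ?G by (rule pair_fin_digraph_loop_dag)
  have "scc_of u = {u}" if "u < n" for u
  proof -
    have "u \<rightarrow>\<^sup>*\<^bsub>with_proj ?G\<^esub> u"
      using that by (simp add: reachable_def loop_dag_def)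
    then show ?thesis
      unfolding scc_of_def by (auto dest: loop_dag_reachable_le intro: order_antisym)
  qed
  then have verts: "sccs_verts = (\<lambda>u. {u}) ` {..<n}"
    unfolding sccs_verts_conv_scc_of by (auto simp: loop_dag_def)
  have "card sccs = n"
    unfolding card_sccs_verts[symmetric] verts by (simp add: card_image)
  moreover have "digraph_diameter C = 0" if "C \<in> sccs" for C
  proof -
    have "verts C \<in> sccs_verts" using that by (simp add: sccs_verts_conv)
    then obtain u where "verts C = {u}" unfolding verts by blast
    then show ?thesis by (rule digraph_diameter_singleton)
  qed
  ultimately show ?thesis
    by (simp add: scc_measure_def loop_dag_input_def)
qed

lemma not_buchi_loop_dag_input: "\<not> buchi (loop_dag_input n {})"
proof
  assume "buchi (loop_dag_input n {})"
  then obtain p where "\<And>i. (p i, p (Suc i)) \<in> parcs (loop_dag n {})"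
    unfolding buchi_def loop_dag_input_def by auto
  then have step: "p i < p (Suc i) \<and> p (Suc i) < n" for i
    by (auto simp: loop_dag_def)
  then have "strict_mono p" by (simp add: strict_mono_Suc_iff)
  \<comment> \<open>A strictly increasing sequence of naturals cannot stay below
    \<open>n\<close>.\<close>
  then have "n \<le> p n" by (rule strict_mono_imp_increasing)
  then show False using step[of n] by linarith
qed

lemma buchi_loop_dag_input:
  assumes "i < n" shows "buchi (loop_dag_input n {i})"
  unfolding buchi_def
\<comment> \<open>The path takes the arc from 0 to \<open>i\<close> and then stays on the loop; for
  \<open>i = 0\<close> it uses the loop from the start.\<close>
proof (intro exI[of _ "\<lambda>k. if k = 0 then 0 else i"] conjI allI)
  let ?K = "{k::nat. (if k = 0 then 0 else i) = i}"
  have "{1..} \<subseteq> ?K" by auto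
  from infinite_super[OF this infinite_Ici] have "infinite ?K" .
  moreover have "i \<in> target_of (loop_dag_input n {i})"
    using assms by (simp add: loop_dag_input_def)
  ultimately show "\<exists>t\<in>target_of (loop_dag_input n {i}). infinite {k::nat. (if k = 0 then 0 else i) = t}"
    by (rule rev_bexI[rotated])
qed (use assms in \<open>auto simp: loop_dag_input_def loop_dag_def\<close>)

text \<open>The loop can only add \<open>i\<close> to the result, and any smaller element of
  \<open>S\<close> has an arc to \<open>i\<close> already.\<close>

lemma Post_loop_dag_distinct:
  assumes "Post (loop_dag n {i}) S \<noteq> Post (loop_dag n {}) S"
  shows "i \<in> S \<and> (\<forall>k\<in>S. i \<le> k)"
  using assms unfolding Post_def loop_dag_def by auto (meson not_le)

text \<open>Dually, a larger vertex in \<open>S\<close> is already a successor of \<open>i\<close>.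
  Numbers from \<open>n\<close> on are not vertices, whence the restriction to
  \<open>k < n\<close>.\<close>

lemma Pre_loop_dag_distinct:
  assumes "Pre (loop_dag n {i}) S \<noteq> Pre (loop_dag n {}) S"
  shows "i < n \<and> i \<in> S \<and> (\<forall>k\<in>S. k < n \<longrightarrow> k \<le> i)"
  using assms unfolding Pre_def loop_dag_def by auto

lemma loop_dag_hard_family:
  assumes "0 < n" and "\<And>L. P (loop_dag_input n L)"
  shows "hard_family P n (loop_dag_input n {}) (\<lambda>i. loop_dag_input n {i})"
proof -
  \<comment> \<open>Minimum and maximum are unique, so the queried set determines the index.\<close>
  have "i = j"
    if "op_result (loop_dag n {i}) act \<noteq> op_result (loop_dag n {}) act"
      and "op_result (loop_dag n {j}) act \<noteq> op_result (loop_dag n {}) act" for act i j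
    using that
    by (cases act)
       (auto dest!: Post_loop_dag_distinct Pre_loop_dag_distinct intro: order_antisym)
  moreover have "valid_input (loop_dag_input n L)" for L
    using assms(1) pair_fin_digraph_loop_dag
    by (auto simp: valid_input_def loop_dag_input_def) (auto simp: loop_dag_def)
  moreover have "same_interface (loop_dag_input n {}) (loop_dag_input n L)" for L
    by (simp add: same_interface_def loop_dag_input_def loop_dag_def)
  moreover have "graph_of (loop_dag_input n L) = loop_dag n L" for L
    by (simp add: loop_dag_input_def)
  ultimately show ?thesis
    unfolding hard_family_def
    using assms(2) buchi_loop_dag_input not_buchi_loop_dag_input by metis
qed

section \<open>Paths with all backward arcs\<close>

text \<open>\<open>B\<close> collects the tails of the deleted forward arcs. The case
  \<open>v \<le> u\<close> includes all loops, so a path can stay at \<open>m\<close>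
  forever.\<close>

definition back_path :: "nat \<Rightarrow> nat set \<Rightarrow> nat pair_pre_digraph" where
  "back_path m B = \<lparr>pverts = {..m},
     parcs = {(u, v). u \<le> m \<and> v \<le> m \<and> (v \<le> u \<or> v = Suc u \<and> u \<notin> B)}\<rparr>"

definition back_path_input :: "nat \<Rightarrow> nat set \<Rightarrow> input" where
  "back_path_input m B = \<lparr>graph_of = back_path m B, start_of = 0, target_of = {m}\<rparr>"

lemma pair_fin_digraph_back_path: "pair_fin_digraph (back_path m B)"
proof
  show "finite (parcs (back_path m B))"
    by (rule finite_subset[of _ "{..m} \<times> {..m}"]) (auto simp: back_path_def)
qed (auto simp: back_path_def)

text \<open>No arc raises the vertex number by more than 1; hence \<open>m\<close> is at distance at
  least \<open>m\<close> from 0.\<close>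

lemma back_path_awalk_le:
  "pre_digraph.awalk (with_proj (back_path m B)) u p v \<Longrightarrow> v \<le> u + length p"
proof (induction p arbitrary: u)
  case Nil
  interpret pair_fin_digraph "back_path m B" by (rule pair_fin_digraph_back_path)
  show ?case using Nil by (simp add: awalk_simps)
next
  case (Cons e p)
  interpret pair_fin_digraph "back_path m B" by (rule pair_fin_digraph_back_path)
  have "e \<in> parcs (back_path m B)" "u = fst e" "v \<le> snd e + length p"
    using Cons by (auto simp: awalk_simps)
  then show ?case by (auto simp: back_path_def)
qed

lemma diam_back_path_input: "diam (back_path_input m {}) = m"
proof -
  let ?G = "back_path m {}"
  interpret pair_fin_digraph ?G by (rule pair_fin_digraph_back_path)
  have reach: "v \<le> m \<Longrightarrow> 0 \<rightarrow>\<^sup>*\<^bsub>with_proj ?G\<^esub> v" for v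
  proof (induction v)
    case 0
    then show ?case by (simp add: reachable_def back_path_def)
  next
    case (Suc v)
    then have "(v, Suc v) \<in> parcs ?G" by (simp add: back_path_def)
    with Suc reachable_adj_trans show ?case by simp
  qed
  obtain q where "awalk 0 q m" using reach[of m] unfolding reachable_awalk by auto
  then have "\<exists>k p. awalk 0 p m \<and> length p = k" by blast
  from LeastI_ex[OF this]
  obtain p where "awalk 0 p m" and "length p = digraph_dist (with_proj ?G) 0 m"
    unfolding digraph_dist_def by blast
  with back_path_awalk_le[of m "{}" 0 p m] have "m \<le> digraph_dist (with_proj ?G) 0 m"
    by simp
  also have "\<dots> \<le> digraph_diameter (with_proj ?G)"
    using reach by (intro digraph_dist_le_diameter) (auto simp: back_path_def)
  finally have "m \<le> digraph_diameter (with_proj ?G)" .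
  moreover have "digraph_diameter (with_proj ?G) \<le> m"
  proof (rule digraph_diameter_le)
    fix u v assume "u \<rightarrow>\<^sup>*\<^bsub>with_proj ?G\<^esub> v"
    \<comment> \<open>There are \<open>m + 1\<close> vertices, and every distance is below that
      count.\<close>
    from digraph_dist_less_card[OF this]
    show "digraph_dist (with_proj ?G) u v \<le> m" by (simp add: back_path_def)
  qed (auto simp: back_path_def)
  ultimately show ?thesis by (simp add: diam_def back_path_input_def)
qed

lemma buchi_back_path_input: "buchi (back_path_input m {})"
  unfolding buchi_def
proof (intro exI[of _ "\<lambda>k. min k m"] conjI allI)
  have "{k. min k m = m} = {m..}" by auto
  then show "\<exists>t\<in>target_of (back_path_input m {}). infinite {k. min k m = t}"
    by (simp add: back_path_input_def infinite_Ici)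
qed (auto simp: back_path_input_def back_path_def)

lemma not_buchi_back_path_input:
  assumes "i < m" shows "\<not> buchi (back_path_input m {i})"
proof
  assume "buchi (back_path_input m {i})"
  then obtain p where p: "p 0 = 0" "\<And>k. (p k, p (Suc k)) \<in> parcs (back_path m {i})"
    and inf: "infinite {k. p k = m}"
    unfolding buchi_def back_path_input_def by auto
  \<comment> \<open>With the arc from \<open>i\<close> to \<open>Suc i\<close> gone, no arc leaves
    \<open>{..i}\<close>.\<close>
  have "p k \<le> i" for k
  proof (induction k)
    case (Suc k)
    then show ?case using p(2)[of k] by (auto simp: back_path_def)
  qed (simp add: p)
  then have "{k. p k = m} = {}" using assms by (auto dest: leD)
  then show False using inf by simp
qed

text \<open>Only \<open>Suc i\<close> can drop out of the result, and it stays if \<open>S\<close>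
  contains a vertex above \<open>i\<close>, which leads to it by a backward arc or a loop.\<close>

lemma Post_back_path_distinct:
  assumes "Post (back_path m {i}) S \<noteq> Post (back_path m {}) S"
  shows "i \<le> m \<and> i \<in> S \<and> (\<forall>k\<in>S. k \<le> m \<longrightarrow> k \<le> i)"
proof -
  obtain x where x: "x \<in> Post (back_path m {}) S" "x \<notin> Post (back_path m {i}) S"
    using assms unfolding Post_def back_path_def by auto
  then have "x = Suc i" "i \<in> S" "x \<le> m" by (auto simp: Post_def back_path_def)
  moreover have "k < x" if "k \<in> S" "k \<le> m" for k
    using x(2) that \<open>x \<le> m\<close> by (force simp: Post_def back_path_def)
  ultimately show ?thesis by fastforce
qed

text \<open>Only \<open>i\<close> can drop out, and it stays if \<open>S\<close> has an element
  \<open>k \<le> i\<close>, since \<open>i\<close> has an arc to \<open>k\<close>.\<close>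

lemma Pre_back_path_distinct:
  assumes "Pre (back_path m {i}) S \<noteq> Pre (back_path m {}) S"
  shows "Suc i \<in> S \<and> (\<forall>k\<in>S. Suc i \<le> k)"
proof -
  obtain x where x: "x \<in> Pre (back_path m {}) S" "x \<notin> Pre (back_path m {i}) S"
    using assms unfolding Pre_def back_path_def by auto
  then have "x = i" "Suc i \<in> S" "x \<le> m" by (auto simp: Pre_def back_path_def)
  moreover have "x < k" if "k \<in> S" for k
    using x(2) that \<open>x \<le> m\<close> by (force simp: Pre_def back_path_def)
  ultimately show ?thesis by fastforce
qed

lemma back_path_hard_family:
  assumes "\<And>B. P (back_path_input m B)"
  shows "hard_family P m (back_path_input m {}) (\<lambda>i. back_path_input m {i})"
proof -
  have "i = j"
    if "op_result (back_path m {i}) act \<noteq> op_result (back_path m {}) act"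
      and "op_result (back_path m {j}) act \<noteq> op_result (back_path m {}) act" for act i j
    using that
    by (cases act)
       (force dest!: Post_back_path_distinct Pre_back_path_distinct intro: order_antisym)+
  moreover have "valid_input (back_path_input m B)" for B
    using pair_fin_digraph_back_path
    by (auto simp: valid_input_def back_path_input_def) (auto simp: back_path_def)
  moreover have "same_interface (back_path_input m {}) (back_path_input m B)" for B
    by (simp add: same_interface_def back_path_input_def back_path_def)
  moreover have "graph_of (back_path_input m B) = back_path m B" for B
    by (simp add: back_path_input_def)
  ultimately show ?thesis
    unfolding hard_family_def
    using assms buchi_back_path_input not_buchi_back_path_input by metis
qed

section \<open>Assembly of the five lower bounds\<close>

lemma loop_dag_lower_bound:
  assumes "a > 0"
    and "\<And>n L. 0 < n \<Longrightarrow> P (loop_dag_input n L)"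
    and "\<And>n. 0 < n \<Longrightarrow> n \<le> g (loop_dag_input n {}) \<and> g (loop_dag_input n {}) \<le> a * n"
  shows "buchi_lower_bound P g"
proof (rule buchi_lower_boundI[OF assms(1)])
  fix N
  have "hard_family P (Suc N) (loop_dag_input (Suc N) {}) (\<lambda>i. loop_dag_input (Suc N) {i})"
    using assms(2) by (intro loop_dag_hard_family) auto
  then show "\<exists>m I J. hard_family P m I J \<and> N \<le> g I \<and> g I \<le> a * m"
    using assms(3)[of "Suc N"] by (meson Suc_leD zero_less_Suc)
qed

theorem theorem3p10:
  shows "(\<exists>d0. buchi_lower_bound (\<lambda>I. diam I \<le> d0) num_vertices)
    \<and> buchi_lower_bound (\<lambda>I. num_targets I = 1) diam
    \<and> (\<exists>d0. buchi_lower_bound (\<lambda>I. diam I \<le> d0) num_targets)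
    \<and> buchi_lower_bound (\<lambda>I. True) (\<lambda>I. num_targets I + diam I)
    \<and> buchi_lower_bound (\<lambda>I. True) scc_measure"
proof (intro conjI)
  have vertices: "num_vertices (loop_dag_input n L) = n" for n L
    by (simp add: num_vertices_def loop_dag_input_def loop_dag_def)
  have targets: "num_targets (loop_dag_input n L) = n" for n L
    by (simp add: num_targets_def loop_dag_input_def)
  \<comment> \<open>The base input and all variants have diameter at most 1, so
    \<open>d0 = 1\<close>.\<close>
  show "\<exists>d0. buchi_lower_bound (\<lambda>I. diam I \<le> d0) num_vertices"
    by (intro exI[of _ 1] loop_dag_lower_bound[of 1])
       (simp_all add: diam_loop_dag_input_le[simplified] vertices)
  show "\<exists>d0. buchi_lower_bound (\<lambda>I. diam I \<le> d0) num_targets"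
    by (intro exI[of _ 1] loop_dag_lower_bound[of 1])
       (simp_all add: diam_loop_dag_input_le[simplified] targets)
  show "buchi_lower_bound (\<lambda>I. True) (\<lambda>I. num_targets I + diam I)"
  \<comment> \<open>The factor 2 absorbs the diameter: \<open>n + 1 \<le> 2 * n\<close> for positive
    \<open>n\<close>.\<close>
  proof (rule loop_dag_lower_bound[of 2])
    show "n \<le> num_targets (loop_dag_input n {}) + diam (loop_dag_input n {}) \<and>
        num_targets (loop_dag_input n {}) + diam (loop_dag_input n {}) \<le> 2 * n" if "0 < n" for n
      using diam_loop_dag_input_le[OF that, of "{}"] that unfolding targets by linarith
  qed simp_all
  show "buchi_lower_bound (\<lambda>I. True) scc_measure"
    by (rule loop_dag_lower_bound[of 1]) (simp_all add: scc_measure_loop_dag_input)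
  show "buchi_lower_bound (\<lambda>I. num_targets I = 1) diam"
  \<comment> \<open>Here the factor is 1, as the diameter of the base input equals the number of
    variants.\<close>
  proof (rule buchi_lower_boundI[of 1])
    show "\<exists>m I J. hard_family (\<lambda>I. num_targets I = 1) m I J \<and> N \<le> diam I \<and> diam I \<le> 1 * m" for N
      using back_path_hard_family[of "\<lambda>I. num_targets I = 1" N] diam_back_path_input[of N]
      by (intro exI[of _ N] exI[of _ "back_path_input N {}"] exI[of _ "\<lambda>i. back_path_input N {i}"])
         (simp add: num_targets_def back_path_input_def)
  qed simp
qed

end
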